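(* Let $N\ge 1$, let $a_1<a_2<\dots<a_N$ be positive integers with $\gcd(a_1,\dots,a_N)=1$, and let $w_1,\dots,w_N$ be strictly positive real numbers. Let $G(z)=\frac{1}{1-w_1z^{a_1}-\dots-w_Nz^{a_N}}$ and let $g_k$ denote the coefficient of $z^k$ in the power series expansion $G(z)=\sum_{k=0}^{+\infty}g_kz^k$. Then the sequence $\{g_k\}_{k\in\mathbb{N}\cup\{0\}}$ is the solution of the recurrence $$g_k=w_1g_{k-a_1}+\dots+w_Ng_{k-a_N}\qquad\text{for all } k>0,$$ with initial conditions $g_0=1$ and $g_j=0$ for $-a_N<j<0$.
   Context: $\mathbb{N}$ denotes the positive integers. The power series expansion of $G$ is the one at $z=0$ (equivalently, $G$ is the formal power series inverse of $1-\sum_{i=1}^N w_iz^{a_i}$). The sequence is extended to indices $-a_N<j<0$ by the stated values $g_j=0$. *)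

theory Defs
  imports "HOL-Analysis.Analysis"
begin

text \<open>The generating function, as the formal inverse over the reals. It is a genuine inverse
  whenever all exponents are positive, since the constant coefficient of the denominator is
  then 1.\<close>

definition gen_fps :: "nat \<Rightarrow> (nat \<Rightarrow> nat) \<Rightarrow> (nat \<Rightarrow> real) \<Rightarrow> real fps" where
  "gen_fps N a w = inverse (1 - (\<Sum>i=1..N. fps_const (w i) * fps_X ^ a i))"

text \<open>A sequence indexed by the integers greater than \<open>- a N\<close> is encoded as a function on all
  integers; the equations below only involve its values at such indices when \<open>a N\<close> is the
  largest exponent.\<close>

definition solves_recurrence ::
    "nat \<Rightarrow> (nat \<Rightarrow> nat) \<Rightarrow> (nat \<Rightarrow> real) \<Rightarrow> (int \<Rightarrow> real) \<Rightarrow> bool" where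
  "solves_recurrence N a w h \<longleftrightarrow>
     (\<forall>k>0. h k = (\<Sum>i=1..N. w i * h (k - int (a i)))) \<and>
     h 0 = 1 \<and>
     (\<forall>j. - int (a N) < j \<and> j < 0 \<longrightarrow> h j = 0)"

definition extend_by_zero :: "(nat \<Rightarrow> real) \<Rightarrow> int \<Rightarrow> real" where
  "extend_by_zero g j = (if j < 0 then 0 else g (nat j))"

text \<open>The coefficients of the formal inverse are those of the power series expansion at 0 of
  the rational function of a complex variable.\<close>

lemma gen_fps_expansion:
  assumes "\<forall>i\<in>{1..N}. 0 < a i"
  shows "(\<lambda>z. 1 / (1 - (\<Sum>i=1..N. complex_of_real (w i) * z ^ a i)))
           has_fps_expansion Abs_fps (\<lambda>k. complex_of_real (fps_nth (gen_fps N a w) k))"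
proof -
  define D where "D = 1 - (\<Sum>i=1..N. fps_const (w i) * fps_X ^ a i)"
  define DC where "DC = 1 - (\<Sum>i=1..N. fps_const (complex_of_real (w i)) * fps_X ^ a i)"
  let ?F = "Abs_fps (\<lambda>k. complex_of_real (fps_nth (gen_fps N a w) k))"
  have D0: "fps_nth D 0 = 1" and DC0: "fps_nth DC 0 = 1"
    using assms by (auto simp: D_def DC_def fps_sum_nth fps_X_power_nth intro!: sum.neutral)
  have nth: "fps_nth DC n = of_real (fps_nth D n)" for n
    by (auto simp: D_def DC_def fps_sum_nth fps_X_power_nth intro!: sum.cong)
  have "gen_fps N a w = inverse D"
    unfolding gen_fps_def D_def ..
  then have inv: "gen_fps N a w * D = 1"
    using D0 by (simp add: inverse_mult_eq_1)
  have "fps_nth (?F * DC) n = fps_nth 1 n" for n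
  proof -
    have "fps_nth (?F * DC) n = of_real (fps_nth (gen_fps N a w * D) n)"
      by (simp add: fps_mult_nth nth)
    then show ?thesis
      by (simp add: inv)
  qed
  then have "DC * ?F = 1"
    by (simp add: fps_ext mult.commute)
  then have F: "?F = inverse DC"
    by (rule fps_inverse_unique[symmetric])
  have "(\<lambda>z. 1 - (\<Sum>i=1..N. complex_of_real (w i) * z ^ a i)) has_fps_expansion DC"
    unfolding DC_def by (intro fps_expansion_intros)
  then have "(\<lambda>z. inverse (1 - (\<Sum>i=1..N. complex_of_real (w i) * z ^ a i)))
      has_fps_expansion inverse DC"
    using DC0 by (intro has_fps_expansion_inverse) simp_all
  then show ?thesis
    unfolding F by (simp add: inverse_eq_divide)
qed

end

theory Submission
  imports Defs
begin

text \<open>Write \<open>G = 1 / (1 - P)\<close> with \<open>P = w\<^sub>1 z\<^bsup>a\<^sub>1\<^esup> + \<dots> + w\<^sub>N z\<^bsup>a\<^sub>N\<^esup>\<close>. As all exponents are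
  positive, \<open>1 - P\<close> has constant coefficient 1, so \<open>G = 1 + P G\<close> as formal power series. Reading
  off the coefficient of \<open>z\<^sup>k\<close>, where multiplication by \<open>z\<^bsup>a\<^sub>i\<^esup>\<close> shifts the coefficients by
  \<open>a\<^sub>i\<close>, gives the initial value for \<open>k = 0\<close> and the recurrence for \<open>k > 0\<close>
  (\<open>gen_fps_nth\<close>). Conversely, since every \<open>a\<^sub>i\<close> lies between 1 and \<open>a\<^sub>N\<close>, the recurrence at
  \<open>k > 0\<close> expresses the value at \<open>k\<close> by values at indices in the range from \<open>1 - a\<^sub>N\<close> to
  \<open>k - 1\<close>, so strong induction shows that it has at most one solution
  (\<open>solves_recurrence_unique\<close>).\<close>

lemma gen_fps_eq:
  assumes "\<forall>i\<in>{1..N}. a i > 0"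
  shows "gen_fps N a w = 1 + (\<Sum>i=1..N. fps_const (w i) * (fps_X ^ a i * gen_fps N a w))"
proof -
  define P where "P = (\<Sum>i=1..N. fps_const (w i) * fps_X ^ a i)"
  have "fps_nth (1 - P) 0 = 1"
    using assms by (auto simp: P_def fps_sum_nth fps_X_power_nth intro!: sum.neutral)
  then have "gen_fps N a w * (1 - P) = 1"
    by (simp add: gen_fps_def P_def inverse_mult_eq_1)
  then have "gen_fps N a w = 1 + P * gen_fps N a w"
    by (simp add: algebra_simps)
  then show ?thesis
    by (simp add: P_def sum_distrib_right mult.assoc)
qed

lemma gen_fps_nth:
  assumes "\<forall>i\<in>{1..N}. a i > 0"
  shows "fps_nth (gen_fps N a w) k = (if k = 0 then 1 else 0) +
    (\<Sum>i=1..N. w i * extend_by_zero (fps_nth (gen_fps N a w)) (int k - int (a i)))"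
proof -
  have "fps_nth (fps_X ^ a i * gen_fps N a w) k =
      extend_by_zero (fps_nth (gen_fps N a w)) (int k - int (a i))" for i
    by (simp add: fps_X_power_mult_nth extend_by_zero_def nat_diff_distrib)
  moreover have "fps_nth (gen_fps N a w) k = (if k = 0 then 1 else 0) +
      (\<Sum>i=1..N. w i * fps_nth (fps_X ^ a i * gen_fps N a w) k)"
    by (subst gen_fps_eq[OF assms]) (simp add: fps_sum_nth)
  ultimately show ?thesis
    by simp
qed

lemma solves_recurrence_gen_fps:
  assumes "\<forall>i\<in>{1..N}. a i > 0"
  shows "solves_recurrence N a w (extend_by_zero (fps_nth (gen_fps N a w)))"
    (is "solves_recurrence N a w ?h")
  unfolding solves_recurrence_def
proof (intro conjI allI impI)
  fix k :: int assume "k > 0"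
  then show "?h k = (\<Sum>i=1..N. w i * ?h (k - int (a i)))"
    using gen_fps_nth[OF assms, of w "nat k"] by (simp add: extend_by_zero_def)
next
  have "(\<Sum>i=1..N. w i * ?h (int 0 - int (a i))) = 0"
    using assms by (intro sum.neutral) (simp add: extend_by_zero_def)
  then show "?h 0 = 1"
    using gen_fps_nth[OF assms, of w 0] by (simp add: extend_by_zero_def)
next
  fix j assume "- int (a N) < j \<and> j < 0"
  then show "?h j = 0"
    by (simp add: extend_by_zero_def)
qed

lemma solves_recurrence_unique:
  assumes a: "\<forall>i\<in>{1..N}. 0 < a i \<and> a i \<le> a N"
    and h: "solves_recurrence N a w h" and h': "solves_recurrence N a w h'"
    and "j > - int (a N)"
  shows "h j = h' j"
  using \<open>j > - int (a N)\<close>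
proof (induction "nat j" arbitrary: j rule: less_induct)
  case less
  show ?case
  proof (cases "j > 0")
    case False
    then show ?thesis
      using h h' less.prems by (cases "j = 0") (auto simp: solves_recurrence_def)
  next
    case True
    have "h (j - int (a i)) = h' (j - int (a i))" if "i \<in> {1..N}" for i
      using a that True by (intro less.hyps) force+
    then have "(\<Sum>i=1..N. w i * h (j - int (a i))) = (\<Sum>i=1..N. w i * h' (j - int (a i)))"
      by (intro sum.cong) auto
    then show ?thesis
      using h h' True by (simp add: solves_recurrence_def)
  qed
qed

theorem lemma2p1:
  fixes N :: nat and a :: "nat \<Rightarrow> nat" and w :: "nat \<Rightarrow> real" and g :: "nat \<Rightarrow> real"
  assumes "N \<ge> 1"
    and "\<forall>i\<in>{1..N}. a i > 0"
    and "strict_mono_on {1..N} a"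
    and "Gcd (a ` {1..N}) = 1"
    and "\<forall>i\<in>{1..N}. w i > 0"
    and "\<forall>k. g k = fps_nth (gen_fps N a w) k"
  shows "solves_recurrence N a w (extend_by_zero g) \<and>
    (\<forall>h. solves_recurrence N a w h \<longrightarrow> (\<forall>j. j > - int (a N) \<longrightarrow> h j = extend_by_zero g j))"
proof -
  have "g = fps_nth (gen_fps N a w)"
    using assms(6) by auto
  then have g: "solves_recurrence N a w (extend_by_zero g)"
    using solves_recurrence_gen_fps[OF assms(2)] by simp
  have "\<forall>i\<in>{1..N}. 0 < a i \<and> a i \<le> a N"
    using assms(1,2) strict_mono_on_leD[OF assms(3)] by simp
  then show ?thesis
    using g solves_recurrence_unique by blast
qed

end
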